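(* Let $\mathbb{K}$ be a field of characteristic $0$ and $\lambda\in\mathbb{K}$ nonzero. (i) Let $(A,B,P)$ be a relative averaging algebra of weight $\lambda$. Then the vector space $B$ with the operations $$x\dashv_Py=x\cdot P(y),\qquad x\vdash_Py=P(x)\cdot y,\qquad x\perp_Py=\lambda xy\qquad(x,y\in B)$$ is a triassociative algebra. (ii) Let $(A,B,P)$ and $(A',B',P')$ be two relative averaging algebras of weight $\lambda$ and $(\varphi,\psi)$ a morphism between them. Then $\psi:B\to B'$ is a morphism of triassociative algebras from $(B,\dashv_P,\vdash_P,\perp_P)$ to $(B',\dashv_{P'},\vdash_{P'},\perp_{P'})$.
   Context: An associative $A$-bimodule is an associative algebra $B$ (product $xy$) with linear maps $A\otimes B\to B$, $(a,x)\mapsto a\cdot x$ and $B\otimes A\to B$, $(x,a)\mapsto x\cdot a$ such that for all $a,b\in A$, $x,y\in B$: $(ab)\cdot x=a\cdot(b\cdot x)$, $(a\cdot x)\cdot b=a\cdot(x\cdot b)$, $(x\cdot a)\cdot b=x\cdot(ab)$, $(xy)\cdot a=x(y\cdot a)$, $(x\cdot a)y=x(a\cdot y)$, $(a\cdot x)y=a\cdot(xy)$. A relative averaging algebra of weight $\lambda$ is a triple $(A,B,P)$ with $A$ an associative algebra, $B$ an associative $A$-bimodule and $P:B\to A$ linear with $P(x)P(y)=P(P(x)\cdot y)=P(x\cdot P(y))=\lambda P(xy)$ for all $x,y\in B$. A morphism $(A,B,P)\to(A',B',P')$ is a pair of algebra homomorphisms $\varphi:A\to A'$, $\psi:B\to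 B'$ with $\psi(a\cdot x)=\varphi(a)\cdot'\psi(x)$, $\psi(x\cdot a)=\psi(x)\cdot'\varphi(a)$ and $\varphi\circ P=P'\circ\psi$. A triassociative algebra is a vector space $D$ with three bilinear operations $\dashv,\vdash,\perp$ such that for all $x,y,z\in D$: $(x\dashv y)\dashv z=x\dashv(y\dashv z)=x\dashv(y\vdash z)=x\dashv(y\perp z)$; $(x\vdash y)\dashv z=x\vdash(y\dashv z)$; $(x\dashv y)\vdash z=(x\vdash y)\vdash z=(x\perp y)\vdash z=x\vdash(y\vdash z)$; $(x\perp y)\dashv z=x\perp(y\dashv z)$; $(x\dashv y)\perp z=x\perp(y\vdash z)$; $(x\vdash y)\perp z=x\vdash(y\perp z)$; $(x\perp y)\perp z=x\perp(y\perp z)$. Morphisms of triassociative algebras are linear maps preserving the three operations. *)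

theory Defs
  imports Complex_Main
begin

text \<open>
  Vector spaces are types of class \<open>ab_group_add\<close> with an explicit scalar multiplication
  (locale \<open>vector_space\<close>); products are explicit functions. No algebra is assumed to be unital.
\<close>

definition bilinear_map ::
  "('k::field \<Rightarrow> 'a::ab_group_add \<Rightarrow> 'a) \<Rightarrow> ('k \<Rightarrow> 'b::ab_group_add \<Rightarrow> 'b) \<Rightarrow>
   ('k \<Rightarrow> 'c::ab_group_add \<Rightarrow> 'c) \<Rightarrow> ('a \<Rightarrow> 'b \<Rightarrow> 'c) \<Rightarrow> bool" where
  "bilinear_map s1 s2 s3 f \<longleftrightarrow>
     (\<forall>x. Vector_Spaces.linear s2 s3 (\<lambda>y. f x y)) \<and>
     (\<forall>y. Vector_Spaces.linear s1 s3 (\<lambda>x. f x y))"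

locale assoc_algebra = vector_space s
  for s :: "'k::field \<Rightarrow> 'a::ab_group_add \<Rightarrow> 'a" +
  fixes m :: "'a \<Rightarrow> 'a \<Rightarrow> 'a"
  assumes mult_bilinear: "bilinear_map s s s m"
    and mult_assoc: "m (m x y) z = m x (m y z)"

locale assoc_algebra_hom =
  src: assoc_algebra s m + tgt: assoc_algebra s' m' + Vector_Spaces.linear s s' f
  for s :: "'k::field \<Rightarrow> 'a::ab_group_add \<Rightarrow> 'a" and m
    and s' :: "'k \<Rightarrow> 'b::ab_group_add \<Rightarrow> 'b" and m'
    and f :: "'a \<Rightarrow> 'b" +
  assumes hom_mult: "f (m x y) = m' (f x) (f y)"

text \<open>\<open>l a x\<close> is the left action \<open>a \<cdot> x\<close>, and \<open>r x a\<close> is the right action \<open>x \<cdot> a\<close>.\<close>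

locale assoc_bimodule = A: assoc_algebra sA mA + B: assoc_algebra sB mB
  for sA :: "'k::field \<Rightarrow> 'a::ab_group_add \<Rightarrow> 'a" and mA
    and sB :: "'k \<Rightarrow> 'b::ab_group_add \<Rightarrow> 'b" and mB +
  fixes l :: "'a \<Rightarrow> 'b \<Rightarrow> 'b" and r :: "'b \<Rightarrow> 'a \<Rightarrow> 'b"
  assumes left_bilinear: "bilinear_map sA sB sB l"
    and right_bilinear: "bilinear_map sB sA sB r"
    and left_act: "l (mA a b) x = l a (l b x)"
    and left_right_act: "r (l a x) b = l a (r x b)"
    and right_act: "r (r x a) b = r x (mA a b)"
    and mult_right: "r (mB x y) a = mB x (r y a)"
    and mult_middle: "mB (r x a) y = mB x (l a y)"
    and mult_left: "mB (l a x) y = l a (mB x y)"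

locale rel_averaging_algebra =
  assoc_bimodule sA mA sB mB l r + P: Vector_Spaces.linear sB sA P
  for lam :: "'k::field"
    and sA :: "'k \<Rightarrow> 'a::ab_group_add \<Rightarrow> 'a" and mA
    and sB :: "'k \<Rightarrow> 'b::ab_group_add \<Rightarrow> 'b" and mB l r
    and P :: "'b \<Rightarrow> 'a" +
  assumes averaging_left: "mA (P x) (P y) = P (l (P x) y)"
    and averaging_right: "P (l (P x) y) = P (r x (P y))"
    and averaging_weight: "P (r x (P y)) = sA lam (P (mB x y))"

locale rel_averaging_hom =
  src: rel_averaging_algebra lam sA mA sB mB l r P +
  tgt: rel_averaging_algebra lam sA' mA' sB' mB' l' r' P' +
  phi: assoc_algebra_hom sA mA sA' mA' \<phi> +
  psi: assoc_algebra_hom sB mB sB' mB' \<psi>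
  for lam :: "'k::field"
    and sA :: "'k \<Rightarrow> 'a::ab_group_add \<Rightarrow> 'a" and mA
    and sB :: "'k \<Rightarrow> 'b::ab_group_add \<Rightarrow> 'b" and mB l r P
    and sA' :: "'k \<Rightarrow> 'c::ab_group_add \<Rightarrow> 'c" and mA'
    and sB' :: "'k \<Rightarrow> 'd::ab_group_add \<Rightarrow> 'd" and mB' l' r' P'
    and \<phi> :: "'a \<Rightarrow> 'c" and \<psi> :: "'b \<Rightarrow> 'd" +
  assumes hom_left: "\<psi> (l a x) = l' (\<phi> a) (\<psi> x)"
    and hom_right: "\<psi> (r x a) = r' (\<psi> x) (\<phi> a)"
    and hom_P: "\<phi> \<circ> P = P' \<circ> \<psi>"

text \<open>The parameters \<open>dl\<close>, \<open>dr\<close>, \<open>pp\<close> are the operations \<open>\<stileturn>\<close>, \<open>\<turnstile>\<close>, \<open>\<bottom>\<close>, in this order.\<close>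

locale triassociative_algebra = vector_space s
  for s :: "'k::field \<Rightarrow> 'd::ab_group_add \<Rightarrow> 'd" +
  fixes dl :: "'d \<Rightarrow> 'd \<Rightarrow> 'd" (infixl "\<stileturn>" 70)
    and dr :: "'d \<Rightarrow> 'd \<Rightarrow> 'd" (infixl "\<turnstile>" 70)
    and pp :: "'d \<Rightarrow> 'd \<Rightarrow> 'd" (infixl "\<bottom>" 70)
  assumes dl_bilinear: "bilinear_map s s s (\<stileturn>)"
    and dr_bilinear: "bilinear_map s s s (\<turnstile>)"
    and pp_bilinear: "bilinear_map s s s (\<bottom>)"
    and dl_dl: "(x \<stileturn> y) \<stileturn> z = x \<stileturn> (y \<stileturn> z)"
    and dl_dr: "x \<stileturn> (y \<stileturn> z) = x \<stileturn> (y \<turnstile> z)"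
    and dl_pp: "x \<stileturn> (y \<turnstile> z) = x \<stileturn> (y \<bottom> z)"
    and dr_dl: "(x \<turnstile> y) \<stileturn> z = x \<turnstile> (y \<stileturn> z)"
    and dl_dr_left: "(x \<stileturn> y) \<turnstile> z = (x \<turnstile> y) \<turnstile> z"
    and dr_pp_left: "(x \<turnstile> y) \<turnstile> z = (x \<bottom> y) \<turnstile> z"
    and pp_dr_left: "(x \<bottom> y) \<turnstile> z = x \<turnstile> (y \<turnstile> z)"
    and pp_dl: "(x \<bottom> y) \<stileturn> z = x \<bottom> (y \<stileturn> z)"
    and dl_pp_dr: "(x \<stileturn> y) \<bottom> z = x \<bottom> (y \<turnstile> z)"
    and dr_pp: "(x \<turnstile> y) \<bottom> z = x \<turnstile> (y \<bottom> z)"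
    and pp_pp: "(x \<bottom> y) \<bottom> z = x \<bottom> (y \<bottom> z)"

locale triassociative_hom =
  src: triassociative_algebra s dl dr pp +
  tgt: triassociative_algebra s' dl' dr' pp' +
  Vector_Spaces.linear s s' f
  for s :: "'k::field \<Rightarrow> 'd::ab_group_add \<Rightarrow> 'd" and dl dr pp
    and s' :: "'k \<Rightarrow> 'e::ab_group_add \<Rightarrow> 'e" and dl' dr' pp'
    and f :: "'d \<Rightarrow> 'e" +
  assumes hom_dl: "f (dl x y) = dl' (f x) (f y)"
    and hom_dr: "f (dr x y) = dr' (f x) (f y)"
    and hom_pp: "f (pp x y) = pp' (f x) (f y)"

definition dl_P :: "('b \<Rightarrow> 'a \<Rightarrow> 'b) \<Rightarrow> ('b \<Rightarrow> 'a) \<Rightarrow> 'b \<Rightarrow> 'b \<Rightarrow> 'b" where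
  "dl_P r P x y = r x (P y)"

definition dr_P :: "('a \<Rightarrow> 'b \<Rightarrow> 'b) \<Rightarrow> ('b \<Rightarrow> 'a) \<Rightarrow> 'b \<Rightarrow> 'b \<Rightarrow> 'b" where
  "dr_P l P x y = l (P x) y"

definition pp_P :: "'k \<Rightarrow> ('k \<Rightarrow> 'b \<Rightarrow> 'b) \<Rightarrow> ('b \<Rightarrow> 'b \<Rightarrow> 'b) \<Rightarrow> 'b \<Rightarrow> 'b \<Rightarrow> 'b" where
  "pp_P lam s m x y = s lam (m x y)"

end

theory Submission
  imports Defs
begin

text \<open>The averaging identities, with linearity of \<open>P\<close>, say that \<open>P\<close>
  turns each of the three operations on \<open>B\<close> into the product of \<open>A\<close>:
  \<open>P_left\<close>, \<open>P_right\<close> and \<open>P_scale_mult\<close>. An operand acting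
  through \<open>P\<close> therefore only matters by its image in \<open>A\<close>, so an inner
  product there may be replaced by either of the other two. What remains of each triassociative
  identity is a bimodule law or associativity in \<open>B\<close>, up to powers of \<lambda> that
  bilinearity pulls out. Bilinearity of the operations comes from composing bilinear maps with
  linear ones. A morphism preserves the operations because \<psi> respects actions, products and
  scalars, and \<phi> carries \<open>P\<close> to \<open>P'\<close>.\<close>

lemma bilinear_map_scale:
  assumes "bilinear_map s1 s2 s3 f"
  shows "f (s1 c x) y = s3 c (f x y)" and "f x (s2 c y) = s3 c (f x y)"
proof -
  interpret left: Vector_Spaces.linear s1 s3 "\<lambda>x. f x y"
    using assms by (simp add: bilinear_map_def)
  interpret right: Vector_Spaces.linear s2 s3 "\<lambda>y. f x y"
    using assms by (simp add: bilinear_map_def)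
  show "f (s1 c x) y = s3 c (f x y)" and "f x (s2 c y) = s3 c (f x y)"
    by (fact left.scale, fact right.scale)
qed

lemma bilinear_map_compose_left:
  assumes "bilinear_map s2 s3 s4 f" and "Vector_Spaces.linear s1 s2 g"
  shows "bilinear_map s1 s3 s4 (\<lambda>x y. f (g x) y)"
  using assms Vector_Spaces.linear_compose[OF assms(2)]
  by (auto simp: bilinear_map_def o_def)

lemma bilinear_map_compose_right:
  assumes "bilinear_map s1 s3 s4 f" and "Vector_Spaces.linear s2 s3 g"
  shows "bilinear_map s1 s2 s4 (\<lambda>x y. f x (g y))"
  using assms Vector_Spaces.linear_compose[OF assms(2)]
  by (auto simp: bilinear_map_def o_def)

lemma bilinear_map_scale_result:
  assumes "bilinear_map s1 s2 s3 f"
  shows "bilinear_map s1 s2 s3 (\<lambda>x y. s3 c (f x y))"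
proof -
  interpret vector_space s3
    using assms by (auto simp: bilinear_map_def Vector_Spaces.linear_def)
  \<comment> \<open>Multiplication by the fixed scalar \<open>c\<close> is itself linear, so
    composing it after each partial map of \<open>f\<close> stays linear.\<close>
  note scale = Vector_Spaces.linear_compose[OF _ linear_scale_self[of c], unfolded o_def]
  show ?thesis
    using assms by (simp add: bilinear_map_def scale)
qed

context rel_averaging_algebra
begin

text \<open>The averaging identities are oriented here so that the simplifier always replaces
  \<open>P\<close> of a product in \<open>B\<close> by a product in \<open>A\<close>, where the
  bimodule laws can take over.\<close>

lemma P_left: "P (l (P x) y) = mA (P x) (P y)"
  and P_right: "P (r x (P y)) = mA (P x) (P y)"
  and P_scale_mult: "P (sB lam (mB x y)) = mA (P x) (P y)"
  \<comment> \<open>With the weight identity reversed, all sides meet in the common form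
    \<open>P (r x (P y))\<close>.\<close>
  by (simp_all add: P.scale averaging_left averaging_right flip: averaging_weight)

lemma triassociative_algebra_averaging:
  "triassociative_algebra sB (dl_P r P) (dr_P l P) (pp_P lam sB mB)"
proof unfold_locales
  show "bilinear_map sB sB sB (dl_P r P)"
    using bilinear_map_compose_right[OF right_bilinear P.linear_axioms]
    by (simp add: dl_P_def[abs_def])
  show "bilinear_map sB sB sB (dr_P l P)"
    using bilinear_map_compose_left[OF left_bilinear P.linear_axioms]
    by (simp add: dr_P_def[abs_def])
  show "bilinear_map sB sB sB (pp_P lam sB mB)"
    using bilinear_map_scale_result[OF B.mult_bilinear]
    by (simp add: pp_P_def[abs_def])
\<comment> \<open>For instance, \<open>dl_pp\<close> holds since both sides become
  \<open>r x (mA (P y) (P z))\<close>, and \<open>dl_pp_dr\<close> is \<open>mult_middle\<close>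
  with the middle element \<open>P y\<close>, scaled by \<lambda>.\<close>
qed (simp_all add: dl_P_def dr_P_def pp_P_def P_left P_right P_scale_mult
      left_act left_right_act right_act mult_left mult_middle mult_right B.mult_assoc
      bilinear_map_scale[OF left_bilinear] bilinear_map_scale[OF right_bilinear]
      bilinear_map_scale[OF B.mult_bilinear])

end

lemma (in rel_averaging_hom) triassociative_hom_averaging:
  "triassociative_hom sB (dl_P r P) (dr_P l P) (pp_P lam sB mB)
     sB' (dl_P r' P') (dr_P l' P') (pp_P lam sB' mB') \<psi>"
proof -
  \<comment> \<open>The pointwise form is needed because \<open>hom_left\<close> and
    \<open>hom_right\<close> produce \<phi> applied to a value of \<open>P\<close>.\<close>
  have P: "\<phi> (P x) = P' (\<psi> x)" for x
    using hom_P by (simp add: fun_eq_iff)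
  show ?thesis
    by (intro triassociative_hom.intro triassociative_hom_axioms.intro
        src.triassociative_algebra_averaging tgt.triassociative_algebra_averaging
        psi.linear_axioms)
      (simp_all add: dl_P_def dr_P_def pp_P_def hom_left hom_right P psi.scale psi.hom_mult)
qed

theorem proposition5p4:
  fixes lam :: "'k::field_char_0"
    and sA :: "'k \<Rightarrow> 'a::ab_group_add \<Rightarrow> 'a" and mA :: "'a \<Rightarrow> 'a \<Rightarrow> 'a"
    and sB :: "'k \<Rightarrow> 'b::ab_group_add \<Rightarrow> 'b" and mB :: "'b \<Rightarrow> 'b \<Rightarrow> 'b"
    and l :: "'a \<Rightarrow> 'b \<Rightarrow> 'b" and r :: "'b \<Rightarrow> 'a \<Rightarrow> 'b" and P :: "'b \<Rightarrow> 'a"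
    and sA' :: "'k \<Rightarrow> 'c::ab_group_add \<Rightarrow> 'c" and mA' :: "'c \<Rightarrow> 'c \<Rightarrow> 'c"
    and sB' :: "'k \<Rightarrow> 'd::ab_group_add \<Rightarrow> 'd" and mB' :: "'d \<Rightarrow> 'd \<Rightarrow> 'd"
    and l' :: "'c \<Rightarrow> 'd \<Rightarrow> 'd" and r' :: "'d \<Rightarrow> 'c \<Rightarrow> 'd" and P' :: "'d \<Rightarrow> 'c"
    and \<phi> :: "'a \<Rightarrow> 'c" and \<psi> :: "'b \<Rightarrow> 'd"
  assumes "lam \<noteq> 0"
  shows "(rel_averaging_algebra lam sA mA sB mB l r P \<longrightarrow>
            triassociative_algebra sB (dl_P r P) (dr_P l P) (pp_P lam sB mB)) \<and>
         (rel_averaging_algebra lam sA mA sB mB l r P \<and>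
          rel_averaging_algebra lam sA' mA' sB' mB' l' r' P' \<and>
          rel_averaging_hom lam sA mA sB mB l r P sA' mA' sB' mB' l' r' P' \<phi> \<psi> \<longrightarrow>
            triassociative_hom sB (dl_P r P) (dr_P l P) (pp_P lam sB mB)
              sB' (dl_P r' P') (dr_P l' P') (pp_P lam sB' mB') \<psi>)"
  by (blast intro: rel_averaging_algebra.triassociative_algebra_averaging
      rel_averaging_hom.triassociative_hom_averaging)

end
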